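(* Let $\mathbf A$ be a Stonean residuated lattice. The assignment $F\mapsto\mathbf S_F$, where $\mathbf S_F$ is the subalgebra of $K(\mathbf A)$ with universe $\{(a,b)\in A\times A:\neg a\to\neg\neg b\in F\}$, is a bijection from the set of lattice filters of $\mathbf A$ containing all dense elements onto the set of all admissible subalgebras of $K(\mathbf A)$.
   Context: A bounded commutative residuated lattice is $(A,\vee,\wedge,\cdot,\to,0,1)$ with $(A,\vee,\wedge)$ a lattice, $(A,\cdot,1)$ a commutative monoid, $ab\le c$ iff $a\le b\to c$, $1$ greatest, $0$ least; $\neg x:=x\to0$. It is Stonean if it satisfies $\neg x\vee\neg\neg x=1$. An element $x$ is dense if $\neg x=0$. $K(\mathbf A)$ is the algebra on $A\times A$ with $(a,b)\vee(c,d)=(a\vee c,b\wedge d)$, $(a,b)\wedge(c,d)=(a\wedge c,b\vee d)$, $(a,b)(c,d)=(ac,(a\to d)\wedge(c\to b))$, $(a,b)\to(c,d)=((a\to c)\wedge(d\to b),ad)$, unit $(1,1)$, constant $0$ as $(0,1)$. A subalgebra $\mathbf S$ of $K(\mathbf A)$ is admissible if its elements below $(1,1)$ are exactly all $(a,1)$, $a\in A$. *)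

theory Defs
  imports Main
begin

class bounded_comm_residuated_lattice = lattice + comm_monoid_mult + zero +
  fixes residual :: "'a \<Rightarrow> 'a \<Rightarrow> 'a"  (infixr "\<leadsto>" 60)
  assumes residuation: "a * b \<le> c \<longleftrightarrow> a \<le> b \<leadsto> c"
    and le_one: "a \<le> 1"
    and zero_le: "0 \<le> a"
begin

definition neg :: "'a \<Rightarrow> 'a"
  where "neg x = x \<leadsto> 0"

definition dense_element :: "'a \<Rightarrow> bool"
  where "dense_element x \<longleftrightarrow> neg x = 0"

end

class stonean_residuated_lattice = bounded_comm_residuated_lattice +
  assumes stonean: "sup (neg x) (neg (neg x)) = 1"

text \<open>Filters need not be proper: the whole lattice is a filter.\<close>

definition lattice_filter :: "'a::lattice set \<Rightarrow> bool"
  where "lattice_filter F \<longleftrightarrow>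
    F \<noteq> {} \<and>
    (\<forall>x\<in>F. \<forall>y\<in>F. inf x y \<in> F) \<and>
    (\<forall>x\<in>F. \<forall>y. x \<le> y \<longrightarrow> y \<in> F)"

text \<open>The operations of the algebra \<open>K(A)\<close> on \<open>A \<times> A\<close>, where \<open>A\<close> is the algebra on the
  type \<open>'a\<close>.\<close>

fun K_sup :: "'a \<times> 'a \<Rightarrow> 'a \<times> 'a \<Rightarrow> 'a::bounded_comm_residuated_lattice \<times> 'a"
  where "K_sup (a, b) (c, d) = (sup a c, inf b d)"

fun K_inf :: "'a \<times> 'a \<Rightarrow> 'a \<times> 'a \<Rightarrow> 'a::bounded_comm_residuated_lattice \<times> 'a"
  where "K_inf (a, b) (c, d) = (inf a c, sup b d)"

fun K_mult :: "'a \<times> 'a \<Rightarrow> 'a \<times> 'a \<Rightarrow> 'a::bounded_comm_residuated_lattice \<times> 'a"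
  where "K_mult (a, b) (c, d) = (a * c, inf (a \<leadsto> d) (c \<leadsto> b))"

fun K_imp :: "'a \<times> 'a \<Rightarrow> 'a \<times> 'a \<Rightarrow> 'a::bounded_comm_residuated_lattice \<times> 'a"
  where "K_imp (a, b) (c, d) = (inf (a \<leadsto> c) (d \<leadsto> b), a * d)"

definition K_one :: "'a::bounded_comm_residuated_lattice \<times> 'a"
  where "K_one = (1, 1)"

definition K_zero :: "'a::bounded_comm_residuated_lattice \<times> 'a"
  where "K_zero = (0, 1)"

definition K_le :: "'a::bounded_comm_residuated_lattice \<times> 'a \<Rightarrow> 'a \<times> 'a \<Rightarrow> bool"
  where "K_le x y \<longleftrightarrow> K_inf x y = x"

text \<open>Subalgebras of \<open>K(A)\<close> are identified with their universes.\<close>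

definition K_subalgebra :: "('a::bounded_comm_residuated_lattice \<times> 'a) set \<Rightarrow> bool"
  where "K_subalgebra S \<longleftrightarrow>
    K_one \<in> S \<and> K_zero \<in> S \<and>
    (\<forall>x\<in>S. \<forall>y\<in>S. K_sup x y \<in> S \<and> K_inf x y \<in> S \<and> K_mult x y \<in> S \<and> K_imp x y \<in> S)"

definition admissible_subalgebra :: "('a::bounded_comm_residuated_lattice \<times> 'a) set \<Rightarrow> bool"
  where "admissible_subalgebra S \<longleftrightarrow>
    K_subalgebra S \<and> {x \<in> S. K_le x K_one} = {(a, 1) | a. True}"

definition filter_subalgebra ::
    "'a set \<Rightarrow> ('a::bounded_comm_residuated_lattice \<times> 'a) set"
  where "filter_subalgebra F = {(a, b). neg a \<leadsto> neg (neg b) \<in> F}"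

end

theory Submission
  imports Defs
begin

text \<open>If \<open>F\<close> contains all dense elements, then \<open>x \<in> F\<close> as soon as \<open>\<not>\<not>x \<in> F\<close>, because \<open>\<not>\<not>x\<close> is
  complemented and hence \<open>(x \<or> \<not>x) \<and> \<not>\<not>x = x\<close>, where \<open>x \<or> \<not>x\<close> is dense. Since \<open>a \<or> b\<close> and
  \<open>\<not>a \<rightarrow> \<not>\<not>b\<close> have the same double negation, \<open>S\<^sub>F\<close> consists of the pairs with \<open>a \<or> b \<in> F\<close>. As \<open>F\<close> is
  also closed under products, distributivity of the product over joins makes \<open>S\<^sub>F\<close> a subalgebra. The
  inverse map sends \<open>S\<close> to the filter of all \<open>x\<close> with \<open>(x, 0) \<in> S\<close>.\<close>

section \<open>Residuated lattices\<close>

context bounded_comm_residuated_lattice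
begin

lemma mult_mono_both: "a \<le> b \<Longrightarrow> c \<le> d \<Longrightarrow> a * c \<le> b * d"
proof -
  have mono: "x * z \<le> y * z" if "x \<le> y" for x y z
  proof -
    have "y \<le> z \<leadsto> y * z"
      by (simp flip: residuation)
    then show ?thesis
      unfolding residuation by (rule order_trans[OF that])
  qed
  assume "a \<le> b" "c \<le> d"
  then show "a * c \<le> b * d"
    using order_trans[OF mono[of a b c] mono[of c d b, simplified mult.commute[of _ b]]] by simp
qed

lemma mult_le_left: "a * b \<le> a"
  using mult_mono_both[OF order_refl le_one, of a b] by simp

lemma mult_le_right: "a * b \<le> b"
  using mult_le_left[of b a] by (simp add: mult.commute)

lemma mult_le_inf: "a * b \<le> inf a b"
  by (simp add: mult_le_left mult_le_right)

text \<open>Multiplication by \<open>c\<close> is a left adjoint, so it preserves joins. Stated for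
  upper bounds, this serves to multiply out products of joins.\<close>

lemma sup_mult_le_iff: "sup a b * c \<le> d \<longleftrightarrow> a * c \<le> d \<and> b * c \<le> d"
  by (simp add: residuation)

lemma mult_sup_le_iff: "c * sup a b \<le> d \<longleftrightarrow> c * a \<le> d \<and> c * b \<le> d"
  using sup_mult_le_iff[of a b c d] by (simp add: mult.commute)

lemma le_zero_iff: "a \<le> 0 \<longleftrightarrow> a = 0"
  by (auto intro: order.antisym zero_le)

lemma one_le_iff: "1 \<le> a \<longleftrightarrow> a = 1"
  by (auto intro: order.antisym le_one)

lemma inf_sup_bounds [simp]:
  "inf a 1 = a" "inf 1 a = a" "sup a 1 = 1" "sup 1 a = 1"
  "inf a 0 = 0" "inf 0 a = 0" "sup a 0 = a" "sup 0 a = a"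
  by (auto intro: order.antisym simp: le_one zero_le)

lemma residual_one [simp]: "a \<leadsto> 1 = 1"
  by (simp add: le_one flip: one_le_iff residuation)

lemma residual_mp: "(a \<leadsto> b) * a \<le> b"
  by (simp add: residuation)

lemma le_residual: "b \<le> a \<leadsto> b"
  by (simp add: mult_le_left flip: residuation)

lemma one_residual [simp]: "1 \<leadsto> a = a"
proof (rule order.antisym)
  show "1 \<leadsto> a \<le> a"
    using residual_mp[of 1 a] by simp
  show "a \<le> 1 \<leadsto> a"
    by (rule le_residual)
qed

lemma le_neg_iff: "a \<le> neg b \<longleftrightarrow> a * b = 0"
  by (simp add: neg_def le_zero_iff flip: residuation)

lemma neg_mult [simp]: "neg a * a = 0" "a * neg a = 0"
  using residual_mp[of a 0] by (simp_all add: neg_def le_zero_iff mult.commute)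

lemma neg_one [simp]: "neg 1 = 0"
  by (simp add: neg_def)

lemma neg_antimono: "a \<le> b \<Longrightarrow> neg b \<le> neg a"
  unfolding le_neg_iff
  using mult_mono_both[OF order_refl, of a b "neg b"] by (simp add: le_zero_iff)

lemma le_neg_neg: "a \<le> neg (neg a)"
  by (simp add: le_neg_iff)

lemma neg_neg_neg [simp]: "neg (neg (neg a)) = neg a"
  by (rule order.antisym) (simp_all add: le_neg_neg neg_antimono)

lemma neg_le_residual: "neg a \<le> a \<leadsto> b"
  by (simp add: zero_le flip: residuation)

text \<open>By currying, both sides are the largest \<open>x\<close> with
  \<open>x * neg a * neg b = 0\<close>.\<close>

lemma neg_residual_neg_neg: "neg a \<leadsto> neg (neg b) = neg (neg a * neg b)"
proof (rule order.antisym)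
  have "(neg a \<leadsto> neg (neg b)) * neg a * neg b \<le> neg (neg b) * neg b"
    by (intro mult_mono_both residual_mp order_refl)
  then show "neg a \<leadsto> neg (neg b) \<le> neg (neg a * neg b)"
    by (simp add: le_neg_iff le_zero_iff mult.assoc)
  have "neg (neg a * neg b) * neg a \<le> neg (neg b)"
    by (simp add: le_neg_iff mult.assoc)
  then show "neg (neg a * neg b) \<le> neg a \<leadsto> neg (neg b)"
    by (simp add: residuation)
qed

lemma sup_le_neg_residual: "sup a b \<le> neg a \<leadsto> neg (neg b)"
  by (simp add: le_neg_neg order_trans[OF le_neg_neg neg_le_residual]
      order_trans[OF le_neg_neg le_residual])

end

section \<open>Stonean residuated lattices\<close>

context stonean_residuated_lattice
begin

text \<open>By the Stonean identity, \<open>neg b\<close> and \<open>neg (neg b)\<close> join to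
  \<open>1\<close>. As \<open>a\<close> annihilates the second, multiplying \<open>a\<close> by this
  join leaves at most \<open>a * neg b\<close>.\<close>

lemma le_mult_neg:
  assumes "a \<le> neg b"
  shows "a \<le> a * neg b"
proof -
  have "a * neg (neg b) \<le> neg b * neg (neg b)"
    using assms by (intro mult_mono_both order_refl)
  then have "a * sup (neg b) (neg (neg b)) \<le> a * neg b"
    by (simp add: mult_sup_le_iff le_zero_iff zero_le)
  then show ?thesis
    by (simp add: stonean)
qed

lemma inf_neg_le_mult: "inf a (neg b) \<le> a * neg b"
  by (rule order_trans[OF le_mult_neg[of _ b] mult_mono_both]) simp_all

lemma inf_neg_self: "inf a (neg a) = 0"
  using inf_neg_le_mult[of a a] by (simp add: le_zero_iff)

lemma dense_sup_neg: "dense_element (sup a (neg a))"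
proof -
  have "neg (sup a (neg a)) \<le> inf (neg a) (neg (neg a))"
    by (simp add: neg_antimono)
  then show ?thesis
    by (simp add: dense_element_def inf_neg_self le_zero_iff)
qed

text \<open>Meet with \<open>neg (neg a)\<close> is below product with it, and that product
  annihilates the summand \<open>neg a\<close>.\<close>

lemma inf_sup_neg_le: "inf (sup a (neg a)) (neg (neg a)) \<le> a"
  by (rule order_trans[OF inf_neg_le_mult]) (simp add: sup_mult_le_iff mult_le_left zero_le)

text \<open>Here \<open>a \<le> neg a\<close>, hence \<open>neg (neg a) \<le> neg a\<close>, and the
  Stonean identity forces \<open>neg a = 1\<close>.\<close>

lemma square_zero:
  assumes "a * a = 0"
  shows "a = 0"
proof -
  have "neg (neg a) \<le> neg a"
    using assms by (metis le_neg_iff neg_antimono)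
  then have "neg a = 1"
    using stonean[of a] by (simp add: sup.absorb1)
  then show ?thesis
    by (metis mult_1_left neg_mult(1))
qed

text \<open>The square of \<open>inf a b * neg (a * b)\<close> lies below
  \<open>a * b * neg (a * b) = 0\<close>, so that element vanishes. This will close the filters
  under products.\<close>

lemma inf_le_neg_neg_mult: "inf a b \<le> neg (neg (a * b))"
proof -
  let ?u = "inf a b * neg (a * b)"
  have "?u * ?u = (inf a b * inf a b) * (neg (a * b) * neg (a * b))"
    by (simp add: ac_simps)
  also have "\<dots> \<le> (a * b) * neg (a * b)"
    by (intro mult_mono_both mult_le_left) simp_all
  finally have "?u * ?u = 0"
    by (simp only: neg_mult le_zero_iff)
  then have "?u = 0"
    by (rule square_zero)
  then show ?thesis
    by (simp add: le_neg_iff)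
qed

text \<open>\<open>neg (sup a b)\<close> is below its own square, hence below
  \<open>neg a * neg b\<close>; negation reverses this.\<close>

lemma neg_residual_le_neg_neg_sup: "neg a \<leadsto> neg (neg b) \<le> neg (neg (sup a b))"
proof -
  have "neg (sup a b) \<le> neg (sup a b) * neg (sup a b)"
    by (simp add: le_mult_neg)
  also have "\<dots> \<le> neg a * neg b"
    by (intro mult_mono_both neg_antimono) simp_all
  finally show ?thesis
    by (simp add: neg_residual_neg_neg neg_antimono)
qed

end

section \<open>Filters containing the dense elements\<close>

locale dense_filter =
  fixes F :: "'a::stonean_residuated_lattice set"
  assumes filter: "lattice_filter F"
    and dense: "dense_element x \<Longrightarrow> x \<in> F"
begin

lemma up: "x \<in> F \<Longrightarrow> x \<le> y \<Longrightarrow> y \<in> F"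
  using filter by (auto simp: lattice_filter_def)

lemma inf_mem: "x \<in> F \<Longrightarrow> y \<in> F \<Longrightarrow> inf x y \<in> F"
  using filter by (auto simp: lattice_filter_def)

lemma one_mem: "1 \<in> F"
  by (simp add: dense dense_element_def)

lemma neg_neg_mem: "neg (neg x) \<in> F \<Longrightarrow> x \<in> F"
  using inf_mem[OF dense[OF dense_sup_neg]] inf_sup_neg_le up by blast

lemma mult_mem: "x \<in> F \<Longrightarrow> y \<in> F \<Longrightarrow> x * y \<in> F"
  by (rule neg_neg_mem[OF up[OF inf_mem inf_le_neg_neg_mult]])

lemma mem_filter_subalgebra: "(a, b) \<in> filter_subalgebra F \<longleftrightarrow> sup a b \<in> F"
  using up[OF _ sup_le_neg_residual] neg_neg_mem[OF up[OF _ neg_residual_le_neg_neg_sup]]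
  by (auto simp: filter_subalgebra_def)

lemma swap_mem: "(a, b) \<in> filter_subalgebra F \<longleftrightarrow> (b, a) \<in> filter_subalgebra F"
  by (simp add: mem_filter_subalgebra sup_commute)

text \<open>When \<open>sup a b * sup c d\<close> is multiplied out, every term except
  \<open>b * d\<close> is below \<open>a\<close> or \<open>c\<close>, and
  \<open>b * d \<le> inf b d\<close>.\<close>

lemma K_sup_mem:
  assumes "(a, b) \<in> filter_subalgebra F" "(c, d) \<in> filter_subalgebra F"
  shows "(sup a c, inf b d) \<in> filter_subalgebra F"
proof -
  have "sup a b * sup c d \<le> sup (sup a c) (inf b d)"
    unfolding sup_mult_le_iff mult_sup_le_iff
    by (meson le_supI1 le_supI2 mult_le_inf mult_le_left mult_le_right)
  then show ?thesis
    using assms unfolding mem_filter_subalgebra by (rule up[OF mult_mem, rotated 2])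
qed

text \<open>The mixed terms \<open>a * d\<close> and \<open>b * c\<close> of
  \<open>sup a b * sup c d\<close> are handled after multiplying by the dense elements
  \<open>sup c (neg c)\<close> and \<open>sup a (neg a)\<close>; the whole product stays in
  \<open>F\<close>.\<close>

lemma K_mult_mem:
  assumes "(a, b) \<in> filter_subalgebra F" "(c, d) \<in> filter_subalgebra F"
  shows "(a * c, inf (a \<leadsto> d) (c \<leadsto> b)) \<in> filter_subalgebra F"
proof -
  let ?q = "inf (a \<leadsto> d) (c \<leadsto> b)"
  let ?z = "sup (a * c) ?q"
  have q: "x \<le> ?z" if "x \<le> a \<leadsto> d" "x \<le> c \<leadsto> b" for x
    using that by (simp add: le_supI2)
  \<comment> \<open>The summand \<open>c\<close> leads below \<open>a * c\<close>; the summand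
    \<open>neg c\<close> leads below \<open>?q\<close>, since
    \<open>neg c \<le> c \<leadsto> b\<close> and \<open>d \<le> a \<leadsto> d\<close>.\<close>
  have ad: "a * d * sup c (neg c) \<le> ?z"
  proof -
    have "a * d * c \<le> ?z"
      by (intro le_supI1 mult_mono_both mult_le_left order_refl)
    moreover have "a * d * neg c \<le> ?z"
      by (intro q) (meson le_residual neg_le_residual mult_le_left mult_le_right order_trans)+
    ultimately show ?thesis
      by (simp only: mult_sup_le_iff simp_thms)
  qed
  have bc: "b * c * sup a (neg a) \<le> ?z"
  proof -
    have "b * c * a \<le> ?z"
      by (simp only: mult.commute[of a c]) (intro le_supI1 mult_mono_both mult_le_right order_refl)
    moreover have "b * c * neg a \<le> ?z"
      by (intro q) (meson le_residual neg_le_residual mult_le_left mult_le_right order_trans)+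
    ultimately show ?thesis
      by (simp only: mult_sup_le_iff simp_thms)
  qed
  have bd: "b * d \<le> ?z"
    by (intro q) (meson le_residual mult_le_left mult_le_right order_trans)+
  let ?e = "sup a (neg a) * sup c (neg c)"
  have "a * c * ?e \<le> ?z"
    by (rule le_supI1[OF mult_le_left])
  moreover have "a * d * ?e \<le> ?z"
    by (rule order_trans[OF _ ad]) (intro mult_mono_both mult_le_right order_refl)
  moreover have "b * c * ?e \<le> ?z"
    by (rule order_trans[OF _ bc]) (intro mult_mono_both mult_le_left order_refl)
  moreover have "b * d * ?e \<le> ?z"
    by (rule order_trans[OF mult_le_left bd])
  \<comment> \<open>Moving \<open>?e\<close> to the right keeps it whole while the other two joins
    are multiplied out.\<close>
  ultimately have "sup a b * sup c d \<le> ?e \<leadsto> ?z"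
    by (simp only: residuation[of _ ?e] sup_mult_le_iff mult_sup_le_iff simp_thms)
  then have "sup a b * sup c d * ?e \<le> ?z"
    by (simp only: residuation)
  moreover have "sup a b * sup c d * ?e \<in> F"
    using assms by (simp add: mult_mem dense dense_sup_neg mem_filter_subalgebra)
  ultimately show ?thesis
    using up by (simp add: mem_filter_subalgebra)
qed

text \<open>Exchanging coordinates turns \<open>K_inf\<close> into \<open>K_sup\<close>, and
  \<open>K_imp (a, b) (c, d)\<close> is \<open>K_mult (a, b) (d, c)\<close> with its coordinates
  exchanged.\<close>

lemma K_subalgebra_filter_subalgebra: "K_subalgebra (filter_subalgebra F)"
proof -
  have "K_sup x y \<in> filter_subalgebra F \<and> K_inf x y \<in> filter_subalgebra F \<and>
      K_mult x y \<in> filter_subalgebra F \<and> K_imp x y \<in> filter_subalgebra F"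
    if "x \<in> filter_subalgebra F" "y \<in> filter_subalgebra F" for x y
  proof -
    obtain a b c d where xy: "x = (a, b)" "y = (c, d)"
      by (cases x, cases y)
    have ab: "(a, b) \<in> filter_subalgebra F" and cd: "(c, d) \<in> filter_subalgebra F"
      using that xy by auto
    then have "(b, a) \<in> filter_subalgebra F" "(d, c) \<in> filter_subalgebra F"
      by (simp_all add: swap_mem)
    then show ?thesis
      using ab cd K_sup_mem[of a b c d] K_sup_mem[of b a d c] K_mult_mem[of a b c d]
        K_mult_mem[of a b d c] swap_mem xy by simp
  qed
  then show ?thesis
    by (simp add: K_subalgebra_def K_one_def K_zero_def mem_filter_subalgebra one_mem)
qed

end

section \<open>Admissible subalgebras\<close>

lemma K_le_one_iff: "K_le (a, b) K_one \<longleftrightarrow> b = 1"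
  by (auto simp: K_le_def K_one_def)

lemma admissible_subalgebra_iff:
  "admissible_subalgebra S \<longleftrightarrow> K_subalgebra S \<and> (\<forall>a. (a, 1) \<in> S)"
proof -
  have "{x \<in> S. K_le x K_one} = {(a, 1) |a. (a, 1) \<in> S}"
    by (auto simp: K_le_one_iff)
  then show ?thesis
    by (auto simp: admissible_subalgebra_def)
qed

lemma (in dense_filter) admissible_filter_subalgebra:
  "admissible_subalgebra (filter_subalgebra F)"
  by (simp add: admissible_subalgebra_iff K_subalgebra_filter_subalgebra mem_filter_subalgebra
      one_mem)

locale admissible =
  fixes S :: "('a::stonean_residuated_lattice \<times> 'a) set"
  assumes admissible: "admissible_subalgebra S"
begin

lemma below_one_mem: "(a, 1) \<in> S"
  using admissible by (simp add: admissible_subalgebra_iff)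

lemma K_mem: "x \<in> S \<Longrightarrow> y \<in> S \<Longrightarrow> K_sup x y \<in> S \<and> K_inf x y \<in> S \<and> K_imp x y \<in> S"
  using admissible by (simp add: admissible_subalgebra_iff K_subalgebra_def)

lemma sup_mem: "(a, b) \<in> S \<Longrightarrow> (c, d) \<in> S \<Longrightarrow> (sup a c, inf b d) \<in> S"
  and inf_mem: "(a, b) \<in> S \<Longrightarrow> (c, d) \<in> S \<Longrightarrow> (inf a c, sup b d) \<in> S"
  and imp_mem: "(a, b) \<in> S \<Longrightarrow> (c, d) \<in> S \<Longrightarrow> (inf (a \<leadsto> c) (d \<leadsto> b), a * d) \<in> S"
  using K_mem[of "(a, b)" "(c, d)"] by simp_all

text \<open>Implication into the unit \<open>(1, 1)\<close> exchanges the coordinates.\<close>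

lemma swap_mem: "(a, b) \<in> S \<Longrightarrow> (b, a) \<in> S"
  using imp_mem[OF _ below_one_mem[of 1], of a b] by simp

lemma residual_mem: "(a \<leadsto> c, a) \<in> S"
  using imp_mem[OF below_one_mem below_one_mem, of a c] by simp

lemma neg_mem: "(neg a, a) \<in> S"
  by (simp add: neg_def residual_mem)

definition zero_filter :: "'a set"
  where "zero_filter = {x. (x, 0) \<in> S}"

text \<open>Joining \<open>(x, 0)\<close> with \<open>(y, 1)\<close> gives upward closure. A dense
  \<open>x\<close> enters because \<open>(neg x, x)\<close> is then \<open>(0, x)\<close>.\<close>

lemma dense_filter_zero_filter: "dense_filter zero_filter"
proof
  have "y \<in> zero_filter" if "x \<in> zero_filter" "x \<le> y" for x y
    using that sup_mem[of x 0 y 1] below_one_mem[of y] by (simp add: zero_filter_def sup.absorb2)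
  moreover have "inf x y \<in> zero_filter" if "x \<in> zero_filter" "y \<in> zero_filter" for x y
    using that inf_mem[of x 0 y 0] by (simp add: zero_filter_def)
  moreover have "1 \<in> zero_filter"
    using swap_mem[OF below_one_mem[of 0]] by (simp add: zero_filter_def)
  ultimately show "lattice_filter zero_filter"
    by (auto simp: lattice_filter_def)
  show "x \<in> zero_filter" if "dense_element x" for x
    using that swap_mem[OF neg_mem[of x]] by (simp add: zero_filter_def dense_element_def)
qed

interpretation zero: dense_filter zero_filter
  by (rule dense_filter_zero_filter)

lemma mem_neg: "(a, neg a) \<in> S"
proof -
  have "(sup a (neg a), 0) \<in> S"
    using zero.dense[OF dense_sup_neg] by (simp add: zero_filter_def)
  \<comment> \<open>The pair is a meet with \<open>(neg (neg a), neg a)\<close>, whose first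
    coordinate recovers \<open>a\<close> from a dense element.\<close>
  then have "(inf (sup a (neg a)) (neg (neg a)), neg a) \<in> S"
    using inf_mem[OF _ neg_mem[of "neg a"]] by fastforce
  moreover have "inf (sup a (neg a)) (neg (neg a)) = a"
    by (rule order.antisym) (simp_all add: inf_sup_neg_le le_neg_neg)
  ultimately show ?thesis
    by simp
qed

lemma filter_subalgebra_zero_filter: "filter_subalgebra zero_filter = S"
proof -
  have "(a, b) \<in> S \<longleftrightarrow> sup a b \<in> zero_filter" for a b
  proof
    assume "(a, b) \<in> S"
    \<comment> \<open>Joining with \<open>(neg (neg b), neg b)\<close> makes the second coordinate
      \<open>inf b (neg b) = 0\<close>.\<close>
    then have "(sup a (neg (neg b)), 0) \<in> S"
      using sup_mem[OF _ neg_mem[of "neg b"]] by (metis inf_neg_self)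
    then have "sup a (neg (neg b)) \<in> zero_filter"
      by (simp add: zero_filter_def)
    moreover have "sup a (neg (neg b)) \<le> neg (neg (sup a b))"
      by (meson le_neg_neg le_sup_iff neg_antimono order_trans sup_ge1 sup_ge2)
    ultimately show "sup a b \<in> zero_filter"
      by (rule zero.neg_neg_mem[OF zero.up])
  next
    assume "sup a b \<in> zero_filter"
    then have "(0, sup a b) \<in> S"
      by (simp add: zero_filter_def swap_mem)
    \<comment> \<open>A join with \<open>(a, neg a)\<close> and then a meet with
      \<open>(1, b)\<close> produce first coordinate \<open>a\<close>. The second is
      \<open>b\<close>, because
      \<open>inf (neg a) (sup a b) \<le> sup a b * neg a \<le> b\<close>.\<close>
    then have "(a, inf (neg a) (sup a b)) \<in> S"
      using sup_mem[OF mem_neg[of a]] by fastforce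
    then have "(a, sup (inf (neg a) (sup a b)) b) \<in> S"
      using inf_mem[OF _ swap_mem[OF below_one_mem[of b]]] by fastforce
    moreover have "inf (neg a) (sup a b) \<le> b"
      using inf_neg_le_mult[of "sup a b" a]
      by (rule order_trans[OF eq_refl[OF inf.commute] order_trans])
        (simp add: sup_mult_le_iff mult_le_left zero_le)
    ultimately show "(a, b) \<in> S"
      by (simp add: sup.absorb2)
  qed
  then show ?thesis
    by (auto simp: zero.mem_filter_subalgebra)
qed

end

theorem theorem3p11:
  "bij_betw filter_subalgebra
     {F :: 'a::stonean_residuated_lattice set. lattice_filter F \<and> (\<forall>x. dense_element x \<longrightarrow> x \<in> F)}
     {S. admissible_subalgebra S}"
proof -
  have dense: "{F :: 'a set. lattice_filter F \<and> (\<forall>x. dense_element x \<longrightarrow> x \<in> F)}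
      = Collect dense_filter"
    by (auto simp: dense_filter_def)
  show ?thesis
    unfolding dense
  proof (rule bij_betw_imageI)
    show "inj_on filter_subalgebra (Collect (dense_filter :: 'a set \<Rightarrow> bool))"
    proof (rule inj_onI)
      fix F G :: "'a set"
      assume "F \<in> Collect dense_filter" "G \<in> Collect dense_filter"
        and eq: "filter_subalgebra F = filter_subalgebra G"
      \<comment> \<open>A filter is recovered from the pairs \<open>(x, 0)\<close>, since
        \<open>sup x 0 = x\<close>.\<close>
      then have "x \<in> F \<longleftrightarrow> x \<in> G" for x
        using dense_filter.mem_filter_subalgebra[of F x 0]
          dense_filter.mem_filter_subalgebra[of G x 0] by simp
      then show "F = G"
        by blast
    qed
    have "S \<in> filter_subalgebra ` Collect dense_filter" if "admissible_subalgebra S"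
      for S :: "('a \<times> 'a) set"
    proof -
      interpret admissible S
        by (rule admissible.intro[OF that])
      show ?thesis
        by (rule image_eqI[of _ _ zero_filter])
          (simp_all add: filter_subalgebra_zero_filter dense_filter_zero_filter)
    qed
    then show "filter_subalgebra ` Collect dense_filter
        = {S :: ('a \<times> 'a) set. admissible_subalgebra S}"
      using dense_filter.admissible_filter_subalgebra by blast
  qed
qed

end
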